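(* Let $A$ be an integral domain with field of fractions $Q(A)$, let $p\in Q(A)$ be a plant and let $0\neq\Theta\in Q(A)$ be a signal generator. Let $c=\frac{b}{a}$ be a stabilizing controller of $p$, where $0\neq a\in A$ and $b\in A$ satisfy $a-p\,b=1$ and $p\,a\in A$. The robust regulation problem for $p$ with signal generator $\Theta$ is solvable if and only if there exist $\alpha,\beta,q_1,q_2\in A$ such that $$\alpha\,\Theta^{-1}-\beta\,(b+q_1\,a^2+q_2\,b^2)\,p=1.$$
   Context: An integral domain is a commutative ring with unit $1$ and without zero divisors. A controller $c\in Q(A)$ stabilizes $p\in Q(A)$ if $1-pc\neq 0$ and $\frac{1}{1-pc},\ \frac{p}{1-pc},\ \frac{c}{1-pc}$ all belong to $A$. $\mathrm{Stab}(p)$ denotes the set of all stabilizing controllers of $p$. A controller $c$ is robustly regulating (for $p$, with signal generator $\Theta$) if $c\in\mathrm{Stab}(p)$ and for every $p'\in\mathrm{Stab}(c)$ one has $\Theta\,\frac{1}{1-p'c}\in A$ and $\Theta\,\frac{p'}{1-p'c}\in A$. The robust regulation problem is the problem of finding a robustly regulating controller; it is solvable if such a controller exists. *)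

theory Defs
  imports "HOL-Computational_Algebra.Polynomial_Factorial"
begin

text \<open>
  The integral domain \<open>A\<close> is the type \<open>'a :: idom\<close>; \<open>Q(A)\<close> is \<open>'a fract\<close>.
  A is identified with its image under \<open>to_fract\<close>, so that \<open>x \<in> A\<close> for \<open>x \<in> Q(A)\<close>
  reads \<open>x \<in> integral_elems\<close>.
\<close>

definition integral_elems :: "'a::idom fract set" where
  "integral_elems = range to_fract"

definition stabilizes :: "'a::idom fract \<Rightarrow> 'a fract \<Rightarrow> bool" where
  "stabilizes c p \<longleftrightarrow> 1 - p * c \<noteq> 0 \<and>
     1 / (1 - p * c) \<in> integral_elems \<and>
     p / (1 - p * c) \<in> integral_elems \<and>
     c / (1 - p * c) \<in> integral_elems"

definition Stab :: "'a::idom fract \<Rightarrow> 'a fract set" where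
  "Stab p = {c. stabilizes c p}"

definition robustly_regulating :: "'a::idom fract \<Rightarrow> 'a fract \<Rightarrow> 'a fract \<Rightarrow> bool" where
  "robustly_regulating p \<Theta> c \<longleftrightarrow> c \<in> Stab p \<and>
     (\<forall>p' \<in> Stab c. \<Theta> * (1 / (1 - p' * c)) \<in> integral_elems \<and>
                    \<Theta> * (p' / (1 - p' * c)) \<in> integral_elems)"

definition robust_regulation_solvable :: "'a::idom fract \<Rightarrow> 'a fract \<Rightarrow> bool" where
  "robust_regulation_solvable p \<Theta> \<longleftrightarrow> (\<exists>c. robustly_regulating p \<Theta> c)"

end

theory Submission
  imports Defs
begin

text \<open>
  Write \<open>A\<close> for \<^const>\<open>integral_elems\<close>. A controller \<open>c\<close> stabilizes \<open>p\<close> precisely when it has the form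
  \<open>y / x\<close> with \<open>x \<noteq> 0\<close>, \<open>x - p y = 1\<close> and \<open>x\<close>, \<open>y\<close>, \<open>p x\<close> in \<open>A\<close>; necessarily \<open>x = 1 / (1 - p c)\<close>
  (\<open>stabilizes_iff\<close>). Such a controller is robustly regulating iff \<open>\<Theta> x\<close> and \<open>\<Theta> p x\<close> lie
  in \<open>A\<close> (\<open>robustly_regulating_iff\<close>), because the Bezout identity \<open>x - c (p x) = 1\<close> writes every
  closed-loop quantity of a plant \<open>p'\<close> stabilized by \<open>c\<close> as an \<open>A\<close>-combination of \<open>x\<close> and \<open>p x\<close>.
  Solvability thus asks for some \<open>y\<close> such that, with \<open>x = 1 + p y \<noteq> 0\<close>, the elements \<open>y\<close>, \<open>x\<close>, \<open>p x\<close>,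
  \<open>\<Theta> x\<close>, \<open>\<Theta> p x\<close> all lie in \<open>A\<close>.

  If \<open>y\<close> is such an element, then \<open>r = y - b\<close> satisfies \<open>r, p r, p\<^sup>2 r \<in> A\<close>, and multiplying \<open>r\<close> by
  \<open>(a - p b)\<^sup>2 = 1\<close> shows that \<open>r\<close> lies in the ideal generated by \<open>a\<^sup>2\<close> and \<open>b\<^sup>2\<close>
  (\<open>double_conductor_in_ideal\<close>). Hence \<open>y = b + q\<^sub>1 a\<^sup>2 + q\<^sub>2 b\<^sup>2\<close>, and
  \<open>\<Theta> x \<cdot> \<Theta>\<^sup>-\<^sup>1 - y p = 1\<close> is the required equation with \<open>\<beta> = 1\<close>.

  Conversely, given the equation, put \<open>h = b + q\<^sub>1 a\<^sup>2 + q\<^sub>2 b\<^sup>2\<close>, \<open>g = 1 + p h\<close> and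
  \<open>u = \<alpha> \<Theta>\<^sup>-\<^sup>1 = 1 + \<beta> h p\<close>. Then \<open>x = u g\<close> has all the required memberships, with
  \<open>y = h + \<beta> h g\<close>. It may happen that \<open>u g = 0\<close>; then \<open>x\<close> is replaced by \<open>p d a\<^sup>2\<close> and \<open>y\<close> by
  \<open>y + d a\<^sup>2\<close>, where \<open>d \<noteq> 0\<close> is a denominator of \<open>\<Theta>\<close>. This works since \<open>1 + p y = 0\<close> forces
  \<open>p \<noteq> 0\<close>.
\<close>

lemma to_fract_in_integral_elems [simp]: "to_fract x \<in> integral_elems"
  by (simp add: integral_elems_def)

lemma one_in_integral_elems [simp]: "1 \<in> integral_elems"
  using to_fract_in_integral_elems [of 1] by simp

lemma integral_elemsE:
  assumes "x \<in> integral_elems"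
  obtains y where "x = to_fract y"
  using assms by (auto simp: integral_elems_def)

lemma integral_elems_add:
  assumes "x \<in> integral_elems" "y \<in> integral_elems"
  shows "x + y \<in> integral_elems"
  using assms by (auto elim!: integral_elemsE simp flip: to_fract_add)

lemma integral_elems_diff:
  assumes "x \<in> integral_elems" "y \<in> integral_elems"
  shows "x - y \<in> integral_elems"
  using assms by (auto elim!: integral_elemsE simp flip: to_fract_diff)

lemma integral_elems_mult:
  assumes "x \<in> integral_elems" "y \<in> integral_elems"
  shows "x * y \<in> integral_elems"
  using assms by (auto elim!: integral_elemsE simp flip: to_fract_mult)

lemmas integral_elems_closed =
  integral_elems_add integral_elems_diff integral_elems_mult

lemma ex_denominator:
  fixes x :: "'a::idom fract"
  obtains d :: 'a where "d \<noteq> 0" "x * to_fract d \<in> integral_elems"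
proof (cases x)
  case (Fract n d)
  then have "x * to_fract d = to_fract n"
    by (simp add: to_fract_def eq_fract)
  then show ?thesis
    using Fract that by simp
qed

lemma stabilizes_iff:
  "stabilizes c p \<longleftrightarrow>
     (\<exists>x\<in>integral_elems. \<exists>y\<in>integral_elems.
        x \<noteq> 0 \<and> c = y / x \<and> x - p * y = 1 \<and> p * x \<in> integral_elems)"
  (is "_ \<longleftrightarrow> ?R")
proof
  assume s: "stabilizes c p"
  define x where "x = 1 / (1 - p * c)"
  have nz: "1 - p * c \<noteq> 0"
    using s by (simp add: stabilizes_def)
  have "x \<in> integral_elems" "c * x \<in> integral_elems" "p * x \<in> integral_elems"
    using s by (simp_all add: stabilizes_def x_def)
  moreover have "x \<noteq> 0" "x - p * (c * x) = 1"
    using nz by (simp_all add: x_def field_simps)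
  ultimately show ?R
    by (intro bexI [of _ x] bexI [of _ "c * x"]) auto
next
  assume ?R
  then obtain x y where xy: "x \<in> integral_elems" "y \<in> integral_elems" "x \<noteq> 0" "c = y / x"
    "x - p * y = 1" "p * x \<in> integral_elems"
    by blast
  have "1 - p * c = (x - p * y) / x"
    using xy(3,4) by (simp add: diff_divide_distrib)
  then have "1 - p * c = 1 / x"
    using xy(5) by simp
  then show "stabilizes c p"
    using xy by (simp add: stabilizes_def)
qed

lemma stabilizes_sym: "stabilizes c p \<longleftrightarrow> stabilizes p c"
  by (auto simp: stabilizes_def mult.commute)

text \<open>
  Robust regulation need only be tested at the nominal plant \<open>p\<close> itself.
\<close>
lemma robustly_regulating_iff:
  assumes x: "x \<in> integral_elems" and y: "y \<in> integral_elems" and nz: "x \<noteq> 0"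
    and bezout: "x - p * y = 1" and px: "p * x \<in> integral_elems"
  shows "robustly_regulating p \<Theta> (y / x) \<longleftrightarrow>
    \<Theta> * x \<in> integral_elems \<and> \<Theta> * (p * x) \<in> integral_elems"
proof -
  define c where "c = y / x"
  have st: "stabilizes c p"
    unfolding stabilizes_iff using assms c_def by blast
  have inv_x: "1 - p * c = 1 / x"
    using nz bezout by (simp add: c_def field_simps)
  have c_px: "x - c * (p * x) = 1"
    using nz bezout by (simp add: c_def field_simps)
  have "robustly_regulating p \<Theta> c \<longleftrightarrow>
    \<Theta> * x \<in> integral_elems \<and> \<Theta> * (p * x) \<in> integral_elems" (is "?L \<longleftrightarrow> ?R")
  proof
    assume ?L
    moreover have "p \<in> Stab c"
      using st stabilizes_sym by (auto simp: Stab_def)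
    ultimately have "\<Theta> * (1 / (1 - p * c)) \<in> integral_elems"
      "\<Theta> * (p / (1 - p * c)) \<in> integral_elems"
      unfolding robustly_regulating_def by blast+
    then show ?R
      by (simp add: inv_x)
  next
    assume R: ?R
    have "\<Theta> * (1 / (1 - p' * c)) \<in> integral_elems \<and> \<Theta> * (p' / (1 - p' * c)) \<in> integral_elems"
      if "p' \<in> Stab c" for p'
    proof -
      define x' where "x' = 1 / (1 - p' * c)"
      define z' where "z' = p' / (1 - p' * c)"
      have "1 - p' * c \<noteq> 0" and mem: "x' \<in> integral_elems" "z' \<in> integral_elems"
        and cx': "c * x' \<in> integral_elems"
        using that by (auto simp: Stab_def stabilizes_def x'_def z'_def mult.commute)
      then have "c * z' = x' - 1"
        by (simp add: x'_def z'_def field_simps)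
      then have cz': "c * z' \<in> integral_elems"
        using mem by (simp add: integral_elems_diff)
      \<comment> \<open>multiply by \<open>x - c (p x) = 1\<close>, letting \<open>c\<close> act on the closed-loop quantity of \<open>p'\<close>\<close>
      have *: "\<Theta> * w = w * (\<Theta> * x) - (c * w) * (\<Theta> * (p * x))" for w
      proof -
        have "\<Theta> * w = \<Theta> * w * (x - c * (p * x))"
          by (simp only: c_px mult_1_right)
        then show ?thesis
          by (simp add: algebra_simps)
      qed
      have "\<Theta> * x' \<in> integral_elems"
        unfolding * [of x'] using R mem cx' by (simp add: integral_elems_diff integral_elems_mult)
      moreover have "\<Theta> * z' \<in> integral_elems"
        unfolding * [of z'] using R mem cz' by (simp add: integral_elems_diff integral_elems_mult)
      ultimately show ?thesis
        by (simp add: x'_def z'_def)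
    qed
    then show ?L
      using st by (simp add: robustly_regulating_def Stab_def)
  qed
  then show ?thesis
    by (simp add: c_def)
qed

lemma robust_regulation_solvable_iff:
  "robust_regulation_solvable p \<Theta> \<longleftrightarrow>
     (\<exists>y\<in>integral_elems. 1 + p * y \<noteq> 0 \<and>
        1 + p * y \<in> integral_elems \<and> p * (1 + p * y) \<in> integral_elems \<and>
        \<Theta> * (1 + p * y) \<in> integral_elems \<and> \<Theta> * (p * (1 + p * y)) \<in> integral_elems)"
  (is "_ \<longleftrightarrow> (\<exists>y\<in>_. ?P y)")
proof
  assume "robust_regulation_solvable p \<Theta>"
  then obtain c where c: "robustly_regulating p \<Theta> c"
    by (auto simp: robust_regulation_solvable_def)
  then have "stabilizes c p"
    by (simp add: robustly_regulating_def Stab_def)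
  then obtain x y where xy: "x \<in> integral_elems" "y \<in> integral_elems" "x \<noteq> 0" "c = y / x"
    "x - p * y = 1" "p * x \<in> integral_elems"
    unfolding stabilizes_iff by blast
  then have "\<Theta> * x \<in> integral_elems \<and> \<Theta> * (p * x) \<in> integral_elems"
    using c robustly_regulating_iff by blast
  moreover have "1 + p * y = x"
    using xy(5) by (simp add: algebra_simps)
  ultimately show "\<exists>y\<in>integral_elems. ?P y"
    using xy by auto
next
  assume "\<exists>y\<in>integral_elems. ?P y"
  then obtain y where y: "y \<in> integral_elems" "?P y"
    by blast
  then have "robustly_regulating p \<Theta> (y / (1 + p * y))"
    by (subst robustly_regulating_iff) auto
  then show "robust_regulation_solvable p \<Theta>"
    by (auto simp: robust_regulation_solvable_def)
qed

text \<open>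
  The elements \<open>r\<close> of \<open>A\<close> that \<open>p\<close> and \<open>p\<^sup>2\<close> multiply into \<open>A\<close> belong to the ideal generated by
  \<open>a\<^sup>2\<close> and \<open>b\<^sup>2\<close>; this is the ideal over which the stabilizing controllers of \<open>p\<close> are parametrized.
\<close>
lemma double_conductor_in_ideal:
  assumes bezout: "to_fract a - p * to_fract b = 1"
    and pa: "p * to_fract a \<in> integral_elems"
    and r: "r \<in> integral_elems" "p * r \<in> integral_elems" "p\<^sup>2 * r \<in> integral_elems"
  obtains q1 q2 where "r = to_fract (q1 * a\<^sup>2 + q2 * b\<^sup>2)"
proof -
  obtain n r0 r1 r2 where n: "p * to_fract a = to_fract n" and r0: "r = to_fract r0"
    and r1: "p * r = to_fract r1" and r2: "p\<^sup>2 * r = to_fract r2"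
    using pa r by (meson integral_elemsE)
  define q1 where "q1 = r0 - 2 * r1 * b"
  define q2 where "q2 = r2 + 2 * r1 * n"
  define A where "A = to_fract a"
  define B where "B = to_fract b"
  have AB: "A - p * B = 1"
    using bezout by (simp add: A_def B_def)
  \<comment> \<open>the cross term of \<open>(a - p b)\<^sup>2\<close> is itself in the ideal\<close>
  have cross: "A * B = B * A\<^sup>2 - (p * A) * B\<^sup>2"
  proof -
    have "A * B = A * B * (A - p * B)"
      by (simp only: AB mult_1_right)
    then show ?thesis
      by (simp add: algebra_simps power2_eq_square)
  qed
  have "r = r * (A - p * B)\<^sup>2"
    by (simp only: AB power_one mult_1_right)
  also have "\<dots> = r * A\<^sup>2 - 2 * (p * r) * (A * B) + (p\<^sup>2 * r) * B\<^sup>2"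
    by (simp add: algebra_simps power2_eq_square)
  also have "\<dots> = (r - 2 * (p * r) * B) * A\<^sup>2 + (p\<^sup>2 * r + 2 * (p * r) * (p * A)) * B\<^sup>2"
    unfolding cross by (simp add: algebra_simps)
  also have "\<dots> = (to_fract r0 - 2 * to_fract r1 * B) * A\<^sup>2
      + (to_fract r2 + 2 * to_fract r1 * to_fract n) * B\<^sup>2"
    using r0 r1 r2 n by (simp only: A_def)
  also have "\<dots> = to_fract (q1 * a\<^sup>2 + q2 * b\<^sup>2)"
    by (simp only: q1_def q2_def A_def B_def power2_eq_square mult_2
        to_fract_add to_fract_diff to_fract_mult)
  finally show ?thesis
    by (rule that)
qed

theorem corollary4p4:
  fixes p \<Theta> c :: "'a::idom fract" and a b :: 'a
  assumes "\<Theta> \<noteq> 0"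
    and "a \<noteq> 0"
    and "c = to_fract b / to_fract a"
    and "c \<in> Stab p"
    and "to_fract a - p * to_fract b = 1"
    and "p * to_fract a \<in> integral_elems"
  shows "robust_regulation_solvable p \<Theta> \<longleftrightarrow>
    (\<exists>\<alpha> \<beta> q1 q2 :: 'a.
       to_fract \<alpha> * inverse \<Theta>
         - to_fract \<beta> * to_fract (b + q1 * a\<^sup>2 + q2 * b\<^sup>2) * p = 1)"
    (is "_ \<longleftrightarrow> ?R")
proof
  define A where "A = to_fract a"
  define B where "B = to_fract b"
  have A_eq: "A = 1 + p * B"
    using assms(5) by (simp add: A_def B_def algebra_simps)
  have A: "A \<in> integral_elems" and B: "B \<in> integral_elems" and pA: "p * A \<in> integral_elems"
    using assms(6) by (simp_all add: A_def B_def)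
  assume "robust_regulation_solvable p \<Theta>"
  then obtain y where y: "y \<in> integral_elems" "1 + p * y \<in> integral_elems"
      "p * (1 + p * y) \<in> integral_elems" "\<Theta> * (1 + p * y) \<in> integral_elems"
    unfolding robust_regulation_solvable_iff by blast
  have "y - B \<in> integral_elems"
    using y B by (simp add: integral_elems_diff)
  moreover have "p * (y - B) \<in> integral_elems"
    using integral_elems_diff [OF y(2) A] by (simp add: A_eq algebra_simps)
  moreover have "p\<^sup>2 * (y - B) \<in> integral_elems"
    using integral_elems_diff [OF y(3) pA]
    by (simp add: A_eq algebra_simps power2_eq_square)
  ultimately obtain q1 q2 where q: "y - B = to_fract (q1 * a\<^sup>2 + q2 * b\<^sup>2)"
    using double_conductor_in_ideal [OF assms(5,6)] by blast
  have "y = to_fract (b + q1 * a\<^sup>2 + q2 * b\<^sup>2)"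
    using q by (simp add: B_def algebra_simps)
  moreover obtain \<alpha> where "\<Theta> * (1 + p * y) = to_fract \<alpha>"
    using y(4) by (rule integral_elemsE)
  then have "to_fract \<alpha> * inverse \<Theta> = 1 + p * y"
    using assms(1) by (simp add: field_simps)
  ultimately have "to_fract \<alpha> * inverse \<Theta>
      - to_fract 1 * to_fract (b + q1 * a\<^sup>2 + q2 * b\<^sup>2) * p = 1"
    by (simp add: mult.commute)
  then show ?R
    by blast
next
  define A where "A = to_fract a"
  define B where "B = to_fract b"
  have A_eq: "A = 1 + p * B"
    using assms(5) by (simp add: A_def B_def algebra_simps)
  have A: "A \<in> integral_elems" and B: "B \<in> integral_elems" and pA: "p * A \<in> integral_elems"
    using assms(6) by (simp_all add: A_def B_def)
  assume ?R
  then obtain \<alpha> \<beta> q1 q2 where eq: "to_fract \<alpha> * inverse \<Theta>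
      - to_fract \<beta> * to_fract (b + q1 * a\<^sup>2 + q2 * b\<^sup>2) * p = 1"
    by blast
  define h where "h = to_fract (b + q1 * a\<^sup>2 + q2 * b\<^sup>2)"
  define g where "g = 1 + p * h"
  define u where "u = 1 + to_fract \<beta> * h * p"
  have h: "h \<in> integral_elems"
    unfolding h_def by (rule to_fract_in_integral_elems)
  have h_eq: "h = B + to_fract q1 * A\<^sup>2 + to_fract q2 * B\<^sup>2"
    by (simp add: h_def A_def B_def power2_eq_square)
  have pB: "p * B = A - 1"
    by (simp add: A_eq)
  have "g = A + to_fract q1 * A * (p * A) + to_fract q2 * B * (p * B)"
    unfolding g_def h_eq by (simp add: A_eq algebra_simps power2_eq_square)
  then have g: "g \<in> integral_elems"
    unfolding pB using A B pA by (auto intro!: integral_elems_closed)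
  have "p * g = p * A + to_fract q1 * (p * A) * (p * A) + to_fract q2 * (p * B) * (p * B)"
    unfolding g_def h_eq by (simp add: A_eq algebra_simps power2_eq_square)
  then have pg: "p * g \<in> integral_elems"
    unfolding pB using A pA by (auto intro!: integral_elems_closed)
  have "u = 1 + to_fract \<beta> * (g - 1)"
    by (simp add: u_def g_def algebra_simps)
  then have u: "u \<in> integral_elems"
    using g by (auto intro!: integral_elems_closed)
  have "u = to_fract \<alpha> * inverse \<Theta>"
    using eq by (simp add: u_def h_def algebra_simps)
  then have \<Theta>u: "\<Theta> * u = to_fract \<alpha>"
    using assms(1) by simp
  define y where "y = h + to_fract \<beta> * h * g"
  have x_eq: "1 + p * y = u * g"
    by (simp add: y_def u_def g_def algebra_simps)
  have y: "y \<in> integral_elems"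
    unfolding y_def using h g by (auto intro!: integral_elems_closed)
  show "robust_regulation_solvable p \<Theta>"
  proof (cases "u * g = 0")
    case False
    have *: "p * (u * g) = u * (p * g)" "\<Theta> * (u * g) = to_fract \<alpha> * g"
      "\<Theta> * (u * (p * g)) = to_fract \<alpha> * (p * g)"
      by (simp_all add: mult_ac flip: \<Theta>u)
    then show ?thesis
      unfolding robust_regulation_solvable_iff
      using False y u g pg
      by (intro bexI [of _ y]) (simp_all add: x_eq * integral_elems_mult)
  next
    case True
    then have y0: "1 + p * y = 0"
      by (simp add: x_eq)
    then have "p \<noteq> 0"
      by auto
    obtain d where d: "d \<noteq> 0" "\<Theta> * to_fract d \<in> integral_elems"
      using ex_denominator by blast
    \<comment> \<open>\<open>p\<close>, \<open>p\<^sup>2\<close>, \<open>\<Theta> p\<close> and \<open>\<Theta> p\<^sup>2\<close> all multiply \<open>d a\<^sup>2\<close> to an integral element\<close>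
    define y' where "y' = y + to_fract d * A\<^sup>2"
    have "1 + p * y' = (1 + p * y) + to_fract d * A * (p * A)"
      by (simp add: y'_def algebra_simps power2_eq_square)
    then have x'_eq: "1 + p * y' = to_fract d * A * (p * A)"
      by (simp add: y0)
    have "y' \<in> integral_elems"
      unfolding y'_def power2_eq_square using y A by (auto intro!: integral_elems_closed)
    moreover have "1 + p * y' \<noteq> 0"
      using \<open>p \<noteq> 0\<close> d(1) assms(2) by (simp add: x'_eq A_def)
    moreover have "1 + p * y' \<in> integral_elems"
      by (simp only: x'_eq integral_elems_mult A pA to_fract_in_integral_elems)
    moreover have "p * (1 + p * y') \<in> integral_elems"
    proof -
      have "p * (1 + p * y') = to_fract d * (p * A) * (p * A)"
        by (simp add: x'_eq mult_ac)
      then show ?thesis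
        by (simp only: integral_elems_mult pA to_fract_in_integral_elems)
    qed
    moreover have "\<Theta> * (1 + p * y') \<in> integral_elems"
    proof -
      have "\<Theta> * (1 + p * y') = (\<Theta> * to_fract d) * A * (p * A)"
        by (simp add: x'_eq mult_ac)
      then show ?thesis
        by (simp only: integral_elems_mult d A pA)
    qed
    moreover have "\<Theta> * (p * (1 + p * y')) \<in> integral_elems"
    proof -
      have "\<Theta> * (p * (1 + p * y')) = (\<Theta> * to_fract d) * (p * A) * (p * A)"
        by (simp add: x'_eq mult_ac)
      then show ?thesis
        by (simp only: integral_elems_mult d pA)
    qed
    ultimately show ?thesis
      unfolding robust_regulation_solvable_iff by blast
  qed
qed

end
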